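(* Let $q$ be a prime power, $n\ge0$ an integer, $G$ a finite abelian group, and $H$ an abelian group with $H\cong(\mathbb{Z}/q\mathbb{Z})^n\times G$. Then every tricolored sum-free set in $H$ has cardinality at most $3\cdot\lvert H\rvert\cdot J(q)^n$.
   Context: For real $s>1$, $J(s)=\frac{1}{s}\inf_{0<x<1}\frac{1-x^{s}}{1-x}x^{-\frac{s-1}{3}}$. A tricolored sum-free set in $H$ (additive) is a set $M\subseteq S\times T\times U$, $S,T,U\subseteq H$, that is a 3-dimensional perfect matching on $S\times T\times U$ (each coordinate projection is a bijection onto $S$, $T$, $U$ respectively), with $s+t+u=0$ for $(s,t,u)\in M$ and $s+t+u\neq0$ for $(s,t,u)\in(S\times T\times U)\setminus M$; its cardinality is $\lvert M\rvert$. *)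

theory Defs
  imports
    Complex_Main
    "HOL-Algebra.Product_Groups"
    "HOL-Number_Theory.Prime_Powers"
begin

text \<open>
  Meant for \<open>s > 1\<close>. The function is positive on \<open>(0, 1)\<close>, so the set below is nonempty and bounded
  below, and \<open>INF\<close> on the reals is the genuine infimum.
\<close>

definition J_const :: "real \<Rightarrow> real" where
  "J_const s = (1 / s) *
     (INF x\<in>{0<..<1::real}. (1 - x powr s) / (1 - x) * x powr (- ((s - 1) / 3)))"

definition perfect_matching3 ::
    "'a set \<Rightarrow> 'b set \<Rightarrow> 'c set \<Rightarrow> ('a \<times> 'b \<times> 'c) set \<Rightarrow> bool" where
  "perfect_matching3 S T U M \<longleftrightarrow>
     M \<subseteq> S \<times> T \<times> U \<and>
     bij_betw (\<lambda>(s, t, u). s) M S \<and>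
     bij_betw (\<lambda>(s, t, u). t) M T \<and>
     bij_betw (\<lambda>(s, t, u). u) M U"

text \<open>
  Groups are written multiplicatively here, so \<open>s + t + u = 0\<close> becomes \<open>s \<otimes> t \<otimes> u = \<one>\<close>.
\<close>

definition tricolored_sum_free ::
    "('a, 'm) monoid_scheme \<Rightarrow> ('a \<times> 'a \<times> 'a) set \<Rightarrow> bool" where
  "tricolored_sum_free H M \<longleftrightarrow>
     (\<exists>S T U. S \<subseteq> carrier H \<and> T \<subseteq> carrier H \<and> U \<subseteq> carrier H \<and>
        perfect_matching3 S T U M \<and>
        (\<forall>(s, t, u) \<in> M. s \<otimes>\<^bsub>H\<^esub> t \<otimes>\<^bsub>H\<^esub> u = \<one>\<^bsub>H\<^esub>) \<and>
        (\<forall>(s, t, u) \<in> S \<times> T \<times> U - M. s \<otimes>\<^bsub>H\<^esub> t \<otimes>\<^bsub>H\<^esub> u \<noteq> \<one>\<^bsub>H\<^esub>))"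

end

theory Submission
  imports Defs "HOL-Number_Theory.Cong"
begin

text \<open>
  This is Tao's slice rank argument, carried out with integers modulo a prime \<open>p\<close> dividing \<open>q\<close>.
  On \<open>\<int>/q\<close> the indicator of \<open>0\<close> is \<open>x \<mapsto> (x + q - 1) choose (q - 1)\<close> modulo \<open>p\<close>, so by Vandermonde the
  indicator of \<open>a + b + c = 0\<close> is a combination of products
  \<open>(a choose i) (b choose j) (c choose l)\<close> with \<open>i + j + l \<le> q - 1\<close>. In the \<open>n\<close>-th power each product
  has total degree at most \<open>n (q - 1)\<close>, so one of its three factors has degree at most
  \<open>n (q - 1) / 3\<close>. The group \<open>G\<close> contributes point indicators, which multiplies the number
  of possible factors by \<open>|G|\<close>. A tricolored sum-free set makes the tensor diagonal, hence its size is
  at most three times the number of low-degree factors, and that number is bounded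
  by evaluating the generating function \<open>(1 + t + \<dots> + t ^ (q - 1)) ^ n\<close> at \<open>0 < t < 1\<close>.
\<close>

section \<open>Linear algebra modulo a prime and the bound for diagonal tensors\<close>

text \<open>
  Gaussian elimination modulo \<open>p\<close>: the solutions of \<open>card I\<close> linear equations can be prescribed
  freely outside a set \<open>K\<close> of at most \<open>card I\<close> pivot coordinates.
\<close>

lemma free_coordinates:
  fixes p :: int and f :: "'i \<Rightarrow> 'x \<Rightarrow> int"
  assumes "prime p" "finite I" "finite X"
  obtains K where "K \<subseteq> X" "card K \<le> card I"
    "\<forall>c. \<exists>h. (\<forall>x\<in>X - K. h x = c x) \<and> (\<forall>i\<in>I. p dvd (\<Sum>x\<in>X. h x * f i x))"
proof -
  have "\<exists>K\<subseteq>X. card K \<le> card I \<and>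
    (\<forall>c. \<exists>h. (\<forall>x\<in>X - K. h x = c x) \<and> (\<forall>i\<in>I. p dvd (\<Sum>x\<in>X. h x * f i x)))"
    using assms(2,3)
  proof (induction I arbitrary: X f rule: finite_induct)
    case empty
    show ?case by (intro exI[of _ "{}"]) auto
  next
    case (insert j I)
    show ?case
    proof (cases "\<forall>x\<in>X. p dvd f j x")
      case True
      then have *: "p dvd (\<Sum>x\<in>X. h x * f j x)" for h by (intro dvd_sum) auto
      from insert.IH[OF insert.prems, of f] obtain K where K: "K \<subseteq> X" "card K \<le> card I"
        "\<And>c. \<exists>h. (\<forall>x\<in>X - K. h x = c x) \<and> (\<forall>i\<in>I. p dvd (\<Sum>x\<in>X. h x * f i x))"
        by metis
      show ?thesis
        using K * insert.hyps by (intro exI[of _ K]) (simp add: card_insert_if)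
    next
      case False
      then obtain x0 where x0: "x0 \<in> X" "\<not> p dvd f j x0" by blast
      then have "coprime (f j x0) p"
        using \<open>prime p\<close> by (simp add: prime_imp_coprime coprime_commute)
      then obtain r where "[f j x0 * r = 1] (mod p)"
        using cong_solve_coprime_int by blast
      then have r: "p dvd 1 - f j x0 * r"
        by (metis cong_iff_dvd_diff cong_sym)
      \<comment> \<open>Subtracting the multiple \<open>f i x0 * r\<close> of equation
        \<open>j\<close> kills the coefficient at the pivot \<open>x0\<close> modulo
        \<open>p\<close>.\<close>
      define g where "g i x = f i x - f i x0 * r * f j x" for i x
      have "finite (X - {x0})" using insert.prems by simp
      from insert.IH[OF this, of g] obtain K where K: "K \<subseteq> X - {x0}" "card K \<le> card I"
        "\<And>c. \<exists>h. (\<forall>x\<in>X - {x0} - K. h x = c x) \<and> (\<forall>i\<in>I. p dvd (\<Sum>x\<in>X - {x0}. h x * g i x))"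
        by metis
      have "\<exists>h. (\<forall>x\<in>X - insert x0 K. h x = c x) \<and>
          (\<forall>i\<in>insert j I. p dvd (\<Sum>x\<in>X. h x * f i x))" for c
      proof -
        from K(3)[of c] obtain h where h: "\<And>x. x \<in> X - {x0} - K \<Longrightarrow> h x = c x"
          "\<And>i. i \<in> I \<Longrightarrow> p dvd (\<Sum>x\<in>X - {x0}. h x * g i x)" by metis
        define s where "s = (\<Sum>x\<in>X - {x0}. h x * f j x)"
        \<comment> \<open>This value at \<open>x0\<close> solves equation \<open>j\<close> modulo
          \<open>p\<close>, since \<open>r\<close> inverts \<open>f j x0\<close>. In the other
          equations it turns the coefficients \<open>f i\<close> into \<open>g i\<close>.\<close>
        define h' where "h' = h(x0 := - r * s)"
        have sum_h': "(\<Sum>x\<in>X. h' x * f i x) = (\<Sum>x\<in>X - {x0}. h x * f i x) - r * s * f i x0" for i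
        proof -
          have "(\<Sum>x\<in>X. h' x * f i x) = h' x0 * f i x0 + (\<Sum>x\<in>X - {x0}. h' x * f i x)"
            using insert.prems x0 by (simp add: sum.remove)
          also have "(\<Sum>x\<in>X - {x0}. h' x * f i x) = (\<Sum>x\<in>X - {x0}. h x * f i x)"
            by (rule sum.cong) (auto simp: h'_def)
          finally show ?thesis by (simp add: h'_def)
        qed
        have "(\<Sum>x\<in>X. h' x * f j x) = s * (1 - f j x0 * r)"
          unfolding sum_h' by (simp add: s_def[symmetric] algebra_simps)
        then have "p dvd (\<Sum>x\<in>X. h' x * f j x)" using r by simp
        moreover have "(\<Sum>x\<in>X. h' x * f i x) = (\<Sum>x\<in>X - {x0}. h x * g i x)" for i
          unfolding sum_h' g_def s_def
          by (simp add: sum_subtractf sum_distrib_left right_diff_distrib mult_ac)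
        ultimately show ?thesis using h
          by (intro exI[of _ h']) (auto simp: h'_def)
      qed
      moreover have "card (insert x0 K) \<le> card (insert j I)"
        using K insert.hyps insert.prems by (simp add: card_insert_if finite_subset[OF K(1)])
      ultimately show ?thesis using K(1) x0(1) by (intro exI[of _ "insert x0 K"]) auto
    qed
  qed
  then show ?thesis using that by metis
qed

text \<open>
  Contracting the third index with a vector \<open>h\<close> orthogonal to all \<open>w c\<close> that equals \<open>1\<close> off \<open>K\<close> leaves a
  diagonal matrix of full rank on \<open>M - K\<close> that is a sum of \<open>card A + card B\<close> matrices of rank one.
\<close>

lemma diagonal_tensor_bound:
  fixes p :: int and M :: "'m set" and u :: "'a \<Rightarrow> 'm \<Rightarrow> int" and v :: "'b \<Rightarrow> 'm \<Rightarrow> int"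
    and w :: "'c \<Rightarrow> 'm \<Rightarrow> int" and k :: "'e \<Rightarrow> int"
  assumes p: "prime p" and fin: "finite M" "finite E" "finite A" "finite B" "finite C"
    and cover: "\<And>e. e \<in> E \<Longrightarrow> \<alpha> e \<in> A \<or> \<beta> e \<in> B \<or> \<gamma> e \<in> C"
    and diag: "\<And>x y z. x \<in> M \<Longrightarrow> y \<in> M \<Longrightarrow> z \<in> M \<Longrightarrow>
      [(\<Sum>e\<in>E. k e * u (\<alpha> e) x * v (\<beta> e) y * w (\<gamma> e) z) = of_bool (x = y \<and> y = z)] (mod p)"
  shows "card M \<le> card A + card B + card C"
proof (rule ccontr)
  assume large: "\<not> ?thesis"
  obtain K where K: "K \<subseteq> M" "card K \<le> card C"
    "\<forall>c. \<exists>h. (\<forall>x\<in>M - K. h x = c x) \<and> (\<forall>i\<in>C. p dvd (\<Sum>x\<in>M. h x * w i x))"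
    by (rule free_coordinates[OF p fin(5) fin(1), of w]) (rule that)
  from K(3)[rule_format, of "\<lambda>_. 1"] obtain h where h: "\<And>x. x \<in> M - K \<Longrightarrow> h x = 1"
    "\<And>i. i \<in> C \<Longrightarrow> p dvd (\<Sum>x\<in>M. h x * w i x)" by metis
  define Y where "Y = M - K"
  have finY: "finite Y" using fin by (simp add: Y_def)
  have cardY: "card Y > card A + card B"
    using large K(1,2) card_Diff_subset[of K M] finite_subset[OF K(1) fin(1)]
    by (simp add: Y_def)
  \<comment> \<open>The third factor contracted with \<open>h\<close> is divisible by
    \<open>p\<close> whenever \<open>\<gamma> e\<close> lies in \<open>C\<close>. The terms whose
    first factor lies outside \<open>A\<close> are collected in \<open>g b\<close> according to
    their second factor.\<close>
  define w' where "w' e = (\<Sum>z\<in>M. h z * w (\<gamma> e) z)" for e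
  define g where "g b x = (\<Sum>e\<in>{e\<in>E. \<alpha> e \<notin> A \<and> \<beta> e = b}. k e * u (\<alpha> e) x * w' e)" for b x
  define f where "f = case_sum u g"
  obtain L where L: "L \<subseteq> Y" "card L \<le> card (A <+> B)"
    "\<forall>c. \<exists>h. (\<forall>x\<in>Y - L. h x = c x) \<and> (\<forall>i\<in>A <+> B. p dvd (\<Sum>x\<in>Y. h x * f i x))"
    by (rule free_coordinates[OF p finite_Plus[OF fin(3,4)] finY, of f]) (rule that)
  \<comment> \<open>Since \<open>L\<close> cannot exhaust \<open>Y\<close>, some \<open>h1\<close>
    is 1 at a point \<open>y\<close> and orthogonal modulo \<open>p\<close> to all
    \<open>u a\<close> with \<open>a\<close> in \<open>A\<close> and all \<open>g b\<close> with
    \<open>b\<close> in \<open>B\<close>.\<close>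
  have "card L < card Y" using L(2) cardY fin by (simp add: card_Plus)
  then have "L \<noteq> Y" by auto
  then obtain y where y: "y \<in> Y - L" using L(1) by blast
  from L(3)[rule_format, of "\<lambda>_. 1"] obtain h1 where h1: "h1 y = 1"
    "\<And>i. i \<in> A <+> B \<Longrightarrow> p dvd (\<Sum>x\<in>Y. h1 x * f i x)" using y by metis
  have hA: "p dvd (\<Sum>x\<in>Y. h1 x * u a x)" if "a \<in> A" for a
    using h1(2)[OF InlI[OF that]] by (simp add: f_def)
  have hB: "p dvd (\<Sum>x\<in>Y. h1 x * g b x)" if "b \<in> B" for b
    using h1(2)[OF InrI[OF that]] by (simp add: f_def)
  have yM: "y \<in> M" using y by (auto simp: Y_def)
  have YM: "x \<in> M" if "x \<in> Y" for x using that by (auto simp: Y_def)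
  let ?F = "\<lambda>x z. \<Sum>e\<in>E. k e * u (\<alpha> e) x * v (\<beta> e) y * w (\<gamma> e) z"
  \<comment> \<open>The slice at the fixed middle index \<open>y\<close>, contracted with
    \<open>h1\<close> and \<open>h\<close>, is evaluated twice: diagonality gives 1, the
    decomposition into products gives 0 modulo \<open>p\<close>.\<close>
  let ?T = "\<Sum>x\<in>Y. \<Sum>z\<in>M. h1 x * h z * ?F x z"
  have "[?T = (\<Sum>x\<in>Y. \<Sum>z\<in>M. h1 x * h z * of_bool (x = y \<and> y = z))] (mod p)"
    by (intro cong_sum cong_scalar_left diag yM) (auto simp: YM)
  also have "(\<Sum>x\<in>Y. \<Sum>z\<in>M. h1 x * h z * of_bool (x = y \<and> y = z)) =
      (\<Sum>x\<in>Y. if x = y then h1 y * h y else 0)"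
    by (intro sum.cong refl) (use yM fin(1) in \<open>auto simp: of_bool_def if_distrib sum.delta cong: if_cong\<close>)
  also have "\<dots> = 1" using y h1(1) h(1)[of y] finY by (simp add: Y_def)
  finally have T1: "[?T = 1] (mod p)" .
  have "?T = (\<Sum>x\<in>Y. \<Sum>z\<in>M. \<Sum>e\<in>E. k e * v (\<beta> e) y * (h1 x * u (\<alpha> e) x) * (h z * w (\<gamma> e) z))"
    by (simp add: sum_distrib_left mult_ac)
  also have "\<dots> = (\<Sum>x\<in>Y. \<Sum>e\<in>E. \<Sum>z\<in>M. k e * v (\<beta> e) y * (h1 x * u (\<alpha> e) x) * (h z * w (\<gamma> e) z))"
    by (intro sum.cong refl sum.swap)
  also have "\<dots> = (\<Sum>e\<in>E. \<Sum>x\<in>Y. \<Sum>z\<in>M. k e * v (\<beta> e) y * (h1 x * u (\<alpha> e) x) * (h z * w (\<gamma> e) z))"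
    by (rule sum.swap)
  also have "\<dots> = (\<Sum>e\<in>E. k e * v (\<beta> e) y * (\<Sum>x\<in>Y. h1 x * u (\<alpha> e) x) * w' e)"
    by (simp add: w'_def sum_distrib_left sum_distrib_right mult_ac)
  finally have T: "?T = (\<Sum>e\<in>E. k e * v (\<beta> e) y * (\<Sum>x\<in>Y. h1 x * u (\<alpha> e) x) * w' e)"
    (is "_ = (\<Sum>e\<in>E. ?t e)") .
  let ?E = "{e\<in>E. \<alpha> e \<notin> A}"
  have "(\<Sum>e\<in>E. ?t e) = (\<Sum>e\<in>E - ?E. ?t e) + (\<Sum>e\<in>?E. ?t e)"
    by (rule sum.subset_diff) (use fin in auto)
  moreover have "p dvd (\<Sum>e\<in>E - ?E. ?t e)"
    by (intro dvd_sum dvd_mult2 dvd_mult hA) auto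
  moreover have "p dvd (\<Sum>e\<in>?E. ?t e)"
  proof -
    have "(\<Sum>e\<in>?E. ?t e) = (\<Sum>b\<in>\<beta> ` ?E. \<Sum>e\<in>{e\<in>?E. \<beta> e = b}. ?t e)"
      using fin by (intro sum.image_gen) auto
    moreover have "p dvd (\<Sum>e\<in>{e\<in>?E. \<beta> e = b}. ?t e)" for b
    proof (cases "b \<in> B")
      case True
      have "(\<Sum>e\<in>{e\<in>?E. \<beta> e = b}. ?t e) =
          (\<Sum>e\<in>{e\<in>E. \<alpha> e \<notin> A \<and> \<beta> e = b}. v b y * (\<Sum>x\<in>Y. h1 x * (k e * u (\<alpha> e) x * w' e)))"
        by (intro sum.cong) (auto simp: sum_distrib_left sum_distrib_right mult_ac)
      also have "\<dots> = v b y * (\<Sum>x\<in>Y. h1 x * g b x)"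
        unfolding g_def sum_distrib_left by (rule sum.swap)
      finally show ?thesis using hB[OF True] by simp
    next
      case False
      \<comment> \<open>With the first index outside \<open>A\<close> and the second outside
        \<open>B\<close>, \<open>cover\<close> forces \<open>\<gamma> e\<close> into
        \<open>C\<close>, where \<open>h\<close> makes \<open>w' e\<close> vanish modulo
        \<open>p\<close>.\<close>
      then show ?thesis
        using cover by (intro dvd_sum dvd_mult) (auto simp: w'_def intro!: h(2))
    qed
    ultimately show ?thesis by (simp add: dvd_sum)
  qed
  ultimately have "p dvd ?T" unfolding T by simp
  then have "p dvd 1" using T1 cong_dvd_iff by blast
  then show False using p by (simp add: not_prime_unit)
qed

section \<open>Binomial coefficients modulo \<open>p\<close> as indicators on the integers modulo
  \<open>q\<close>\<close>

text \<open>By the absorption identity, \<open>p ^ k\<close> divides \<open>j\<close> times the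
  binomial coefficient, and the latter is coprime to \<open>p\<close>.\<close>

lemma not_dvd_choose_imp_primepow_dvd:
  fixes p k m j :: nat
  assumes "prime p" "\<not> p dvd (p ^ k * m) choose j" "j > 0"
  shows "p ^ k dvd j"
proof (cases "p ^ k * m")
  case 0
  then show ?thesis using assms by (auto simp: binomial_eq_0)
next
  case (Suc a)
  obtain b where j: "j = Suc b" using assms(3) by (cases j) auto
  have "Suc b * (Suc a choose Suc b) = Suc a * (a choose b)"
    by (rule Suc_times_binomial)
  then have "p ^ k dvd j * ((p ^ k * m) choose j)"
    unfolding Suc j by (metis Suc dvd_mult2 dvd_triv_left)
  moreover have "coprime (p ^ k) ((p ^ k * m) choose j)"
    using prime_imp_coprime[OF assms(1,2)] by simp
  ultimately show ?thesis by (simp add: coprime_dvd_mult_left_iff)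
qed

text \<open>Modulo \<open>p\<close>, the coefficients of \<open>(1 + X) ^ (q * m)\<close> vanish in
  degrees strictly between 0 and \<open>q\<close>. Splitting \<open>x + (q - 1)\<close> into
  \<open>q * m\<close> and a remainder \<open>r\<close>, Vandermonde leaves only
  \<open>r choose (q - 1)\<close>, which is 1 for \<open>r = q - 1\<close> and 0 for smaller
  \<open>r\<close>.\<close>

lemma choose_cong_indicator:
  fixes p k x :: nat
  assumes "prime p"
  defines "q \<equiv> p ^ k"
  shows "[(x + (q - 1)) choose (q - 1) = of_bool (q dvd x)] (mod p)"
proof -
  have q: "q > 0" using assms by (simp add: prime_gt_0_nat)
  define m r where "m = (x + (q - 1)) div q" and "r = (x + (q - 1)) mod q"
  have xr: "x + (q - 1) = q * m + r" by (simp add: m_def r_def)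
  have r: "r < q" using q by (simp add: r_def)
  have "[(x + (q - 1)) choose (q - 1) = (\<Sum>j\<le>q - 1. (q * m choose j) * (r choose (q - 1 - j)))] (mod p)"
    unfolding xr vandermonde by simp
  also have "[(\<Sum>j\<le>q - 1. (q * m choose j) * (r choose (q - 1 - j))) =
     (\<Sum>j\<le>q - 1. of_bool (j = 0) * (r choose (q - 1 - j)))] (mod p)"
  proof (intro cong_sum cong_scalar_right)
    fix j assume "j \<in> {..q - 1}"
    then have "j < q" using q by auto
    show "[q * m choose j = of_bool (j = 0)] (mod p)"
    proof (cases "j = 0")
      case False
      then have "p dvd (q * m choose j)"
        using not_dvd_choose_imp_primepow_dvd[OF assms(1), of k m j] \<open>j < q\<close>
        by (metis q_def False dvd_imp_le gr0I leD)
      then show ?thesis using False by (simp add: cong_0_iff)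
    qed simp
  qed
  also have "(\<Sum>j\<le>q - 1. of_bool (j = 0) * (r choose (q - 1 - j))) = (\<Sum>j\<le>q - 1. if j = 0 then r choose (q - 1) else 0)"
    by (intro sum.cong) auto
  also have "\<dots> = r choose (q - 1)" by simp
  also have "r choose (q - 1) = of_bool (q dvd x)"
  proof (cases "q dvd x")
    case True
    then have "r = q - 1" unfolding r_def using q
      by (metis (no_types, lifting) diff_less dvd_def mod_less mod_mult_self4 zero_less_one)
    then show ?thesis using True by simp
  next
    case False
    have "r \<noteq> q - 1"
    proof
      assume "r = q - 1"
      then have "x = q * m" using xr by simp
      then show False using False by simp
    qed
    then show ?thesis using r False by (simp add: binomial_eq_0)
  qed
  finally show ?thesis .
qed

text \<open>Vandermonde peels off one summand at a time, and the degree left over goes to the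
  constant \<open>m\<close>. The index set encodes \<open>i + j + l \<le> r\<close>, the source of
  the degree bound.\<close>

lemma vandermonde_three:
  "(a + (b + (c + m))) choose r =
    (\<Sum>(i, j, l)\<in>(SIGMA i:{..r}. SIGMA j:{..r - i}. {..r - i - j}).
      (m choose (r - i - j - l)) * (a choose i) * (b choose j) * (c choose l))"
proof -
  have "(a + (b + (c + m))) choose r =
      (\<Sum>i\<le>r. \<Sum>j\<le>r - i. \<Sum>l\<le>r - i - j.
        (m choose (r - i - j - l)) * (a choose i) * (b choose j) * (c choose l))"
    by (simp add: vandermonde[symmetric, of a] vandermonde[symmetric, of b]
        vandermonde[symmetric, of c] sum_distrib_left mult_ac)
  then show ?thesis by (simp add: sum.Sigma)
qed

section \<open>The polynomial decomposition of the indicator tensor\<close>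

text \<open>These vectors index the low-degree factors. The 3 stands on the left to avoid division
  of natural numbers.\<close>

definition low_exponents :: "nat \<Rightarrow> nat \<Rightarrow> (nat \<Rightarrow> nat) set" where
  "low_exponents q n = {e \<in> {..<n} \<rightarrow>\<^sub>E {..<q}. 3 * sum e {..<n} \<le> n * (q - 1)}"

lemma finite_low_exponents [simp]: "finite (low_exponents q n)"
  by (simp add: low_exponents_def finite_PiE)

text \<open>Coordinates modulo \<open>q\<close> are given as natural numbers so that binomial
  coefficients apply to them. By \<open>matching\<close> the indicator tensor of the equation is
  diagonal on \<open>M\<close>, so \<open>diagonal_tensor_bound\<close> applies with the same set of
  low-degree factors in all three places.\<close>

lemma matching_card_bound:
  fixes a b c :: "'m \<Rightarrow> nat \<Rightarrow> nat" and x y z :: "'m \<Rightarrow> 'g" and G (structure)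
  assumes p: "prime p" and q: "q = p ^ k" and G: "group G" and fin: "finite (carrier G)" "finite M"
    and carr: "\<And>m. m \<in> M \<Longrightarrow> x m \<in> carrier G" "\<And>m. m \<in> M \<Longrightarrow> y m \<in> carrier G"
      "\<And>m. m \<in> M \<Longrightarrow> z m \<in> carrier G"
    and matching: "\<And>m1 m2 m3. m1 \<in> M \<Longrightarrow> m2 \<in> M \<Longrightarrow> m3 \<in> M \<Longrightarrow>
      (\<forall>i<n. q dvd a m1 i + b m2 i + c m3 i) \<and> x m1 \<otimes> y m2 \<otimes> z m3 = \<one> \<longleftrightarrow> m1 = m2 \<and> m2 = m3"
  shows "card M \<le> 3 * (card (low_exponents q n) * card (carrier G))"
proof -
  interpret group G by fact
  define r where "r = q - 1"
  have q0: "q > 0" using p q by (simp add: prime_gt_0_nat)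
  define D where "D = (SIGMA i:{..r}. SIGMA j:{..r - i}. {..r - i - j})"
  have finD: "finite D" by (simp add: D_def)
  define PE where "PE = ({..<n} \<rightarrow>\<^sub>E D)"
  have finPE: "finite PE" by (simp add: PE_def finite_PiE finD)
  \<comment> \<open>A term consists of a degree triple for each coordinate and points
    \<open>g\<close>, \<open>h\<close> for the first two group entries. The third point is then
    forced to be \<open>inv (g \<otimes> h)\<close>.\<close>
  define E where "E = PE \<times> (carrier G \<times> carrier G)"
  define A where "A = low_exponents q n \<times> carrier G"
  define \<alpha> where "\<alpha> = (\<lambda>(e, g, h :: 'g). (\<lambda>i\<in>{..<n}. fst (e i :: nat \<times> nat \<times> nat), g :: 'g))"
  define \<beta> where "\<beta> = (\<lambda>(e, g :: 'g, h). (\<lambda>i\<in>{..<n}. fst (snd (e i :: nat \<times> nat \<times> nat)), h :: 'g))"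
  define \<gamma> where "\<gamma> = (\<lambda>(e, g, h). (\<lambda>i\<in>{..<n}. snd (snd (e i :: nat \<times> nat \<times> nat)), inv (g \<otimes> h)))"
  define mono where
    "mono f \<xi> = (\<lambda>(J, g) m. int (\<Prod>i<n. f m i choose J i) * of_bool (\<xi> m = g))"
    for f :: "'m \<Rightarrow> nat \<Rightarrow> nat" and \<xi> :: "'m \<Rightarrow> 'g"
  define coe where
    "coe = (\<lambda>(e, gh :: 'g \<times> 'g). int (\<Prod>i<n. case e i of (i, j, l) \<Rightarrow> r choose (r - i - j - l)))"
  have "card M \<le> card A + card A + card A"
  proof (rule diagonal_tensor_bound[where p = "int p" and E = E and \<alpha> = \<alpha> and \<beta> = \<beta> and \<gamma> = \<gamma>
        and u = "mono a x" and v = "mono b y" and w = "mono c z" and k = coe])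
    show "prime (int p)" using p by simp
    show "finite E" using finPE fin by (simp add: E_def)
    fix t assume "t \<in> E"
    then obtain e g h where t: "t = (e, g, h)" "e \<in> PE" "g \<in> carrier G" "h \<in> carrier G"
      by (auto simp: E_def)
    have eD: "fst (e i) + fst (snd (e i)) + snd (snd (e i)) \<le> r" if "i < n" for i
    proof -
      have "e i \<in> D" using t(2) that by (auto simp: PE_def)
      then show ?thesis by (auto simp: D_def)
    qed
    \<comment> \<open>The three degrees add up to at most \<open>n * r\<close>, so one of them is at
      most a third of that.\<close>
    have "(\<Sum>i<n. fst (e i)) + (\<Sum>i<n. fst (snd (e i))) + (\<Sum>i<n. snd (snd (e i))) \<le> (\<Sum>i<n. r)"
      unfolding sum.distrib[symmetric] by (rule sum_mono) (use eD in auto)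
    then consider "3 * (\<Sum>i<n. fst (e i)) \<le> n * r" | "3 * (\<Sum>i<n. fst (snd (e i))) \<le> n * r"
      | "3 * (\<Sum>i<n. snd (snd (e i))) \<le> n * r" by fastforce
    moreover have low: "(\<lambda>i\<in>{..<n}. d i) \<in> low_exponents q n"
      if "3 * (\<Sum>i<n. d i) \<le> n * r" "\<And>i. i < n \<Longrightarrow> d i \<le> r" for d :: "nat \<Rightarrow> nat"
      using that q0 by (fastforce simp: low_exponents_def r_def)
    ultimately show "\<alpha> t \<in> A \<or> \<beta> t \<in> A \<or> \<gamma> t \<in> A"
    proof cases
      case 1
      then have "\<alpha> t \<in> A" using low[of "\<lambda>i. fst (e i)"] eD t
        by (fastforce simp: A_def \<alpha>_def)
      then show ?thesis by simp
    next
      case 2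
      then have "\<beta> t \<in> A" using low[of "\<lambda>i. fst (snd (e i))"] eD t
        by (fastforce simp: A_def \<beta>_def)
      then show ?thesis by simp
    next
      case 3
      then have "\<gamma> t \<in> A" using low[of "\<lambda>i. snd (snd (e i))"] eD t
        by (fastforce simp: A_def \<gamma>_def)
      then show ?thesis by simp
    qed
  next
    fix m1 m2 m3 assume m: "m1 \<in> M" "m2 \<in> M" "m3 \<in> M"
    define s where "s i = a m1 i + (b m2 i + c m3 i)" for i
    define P where "P \<longleftrightarrow> x m1 \<otimes> y m2 \<otimes> z m3 = \<one>"
    define \<tau> where "\<tau> i = (\<lambda>(j, l, h). (r choose (r - j - l - h)) * (a m1 i choose j) *
      (b m2 i choose l) * (c m3 i choose h))" for i
    have P: "P \<longleftrightarrow> z m3 = inv (x m1 \<otimes> y m2)"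
      unfolding P_def using carr m inv_equality[of "z m3" "x m1 \<otimes> y m2"]
      by (metis m_closed inv_inv inv_equality r_inv)
    \<comment> \<open>The first two point indicators select the single pair
      \<open>gh = (x m1, y m2)\<close>; there the third one becomes \<open>P\<close>.\<close>
    have summand: "coe t * mono a x (\<alpha> t) m1 * mono b y (\<beta> t) m2 * mono c z (\<gamma> t) m3 =
        (case t of (e, gh) \<Rightarrow> int (\<Prod>i<n. \<tau> i (e i)) * (if gh = (x m1, y m2) then of_bool P else 0))" for t
    proof (cases t)
      case (fields e g h)
      have "(\<Prod>i<n. \<tau> i (e i)) = (\<Prod>i<n. case e i of (i, j, l) \<Rightarrow> r choose (r - i - j - l)) *
          (\<Prod>i<n. a m1 i choose fst (e i)) * (\<Prod>i<n. b m2 i choose fst (snd (e i))) *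
          (\<Prod>i<n. c m3 i choose snd (snd (e i)))"
        unfolding prod.distrib[symmetric] by (rule prod.cong) (auto simp: \<tau>_def split: prod.splits)
      then show ?thesis
        by (auto simp: fields coe_def mono_def \<alpha>_def \<beta>_def \<gamma>_def P simp del: of_nat_prod)
    qed
    have "(\<Sum>t\<in>E. coe t * mono a x (\<alpha> t) m1 * mono b y (\<beta> t) m2 * mono c z (\<gamma> t) m3) =
        (\<Sum>e\<in>PE. \<Sum>gh\<in>carrier G \<times> carrier G.
          int (\<Prod>i<n. \<tau> i (e i)) * (if gh = (x m1, y m2) then of_bool P else 0))"
      unfolding summand E_def by (rule sum.cartesian_product[symmetric])
    also have "\<dots> = (\<Sum>e\<in>PE. int (\<Prod>i<n. \<tau> i (e i)) * of_bool P)"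
      unfolding sum_distrib_left[symmetric] using carr m fin by simp
    also have "\<dots> = int (\<Sum>e\<in>PE. \<Prod>i<n. \<tau> i (e i)) * of_bool P"
      by (simp add: sum_distrib_right)
    \<comment> \<open>Independent choices in each coordinate factorise the sum, and each factor is
      an instance of \<open>vandermonde_three\<close> with \<open>m = r\<close>.\<close>
    also have "(\<Sum>e\<in>PE. \<Prod>i<n. \<tau> i (e i)) = (\<Prod>i<n. \<Sum>d\<in>D. \<tau> i d)"
      unfolding PE_def by (rule prod_sum_PiE[symmetric]) (auto simp: finD)
    also have "\<dots> = (\<Prod>i<n. (s i + r) choose r)"
      using vandermonde_three[of _ _ _ r r] by (simp add: \<tau>_def D_def s_def add.assoc)
    finally have sum: "(\<Sum>t\<in>E. coe t * mono a x (\<alpha> t) m1 * mono b y (\<beta> t) m2 * mono c z (\<gamma> t) m3) =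
        int (\<Prod>i<n. (s i + r) choose r) * of_bool P" .
    have "[(\<Prod>i<n. (s i + r) choose r) = (\<Prod>i<n. of_bool (q dvd s i))] (mod p)"
      unfolding r_def q by (intro cong_prod choose_cong_indicator p)
    also have "(\<Prod>i<n. of_bool (q dvd s i)) = (of_bool (\<forall>i<n. q dvd s i) :: nat)"
      by (induction n) (auto simp: less_Suc_eq)
    finally have "[int (\<Prod>i<n. (s i + r) choose r) = int (of_bool (\<forall>i<n. q dvd s i))] (mod int p)"
      by (simp only: cong_int_iff)
    then have "[int (\<Prod>i<n. (s i + r) choose r) * of_bool P =
        int (of_bool (\<forall>i<n. q dvd s i)) * of_bool P] (mod int p)"
      by (rule cong_scalar_right)
    also have "int (of_bool (\<forall>i<n. q dvd s i)) * of_bool P = of_bool (m1 = m2 \<and> m2 = m3)"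
      unfolding matching[OF m, symmetric] P_def s_def by (simp add: add.assoc)
    finally show "[(\<Sum>t\<in>E. coe t * mono a x (\<alpha> t) m1 * mono b y (\<beta> t) m2 * mono c z (\<gamma> t) m3) =
        of_bool (m1 = m2 \<and> m2 = m3)] (mod int p)"
      unfolding sum .
  qed (use fin in \<open>auto simp: A_def\<close>)
  then show ?thesis by (simp add: A_def card_cartesian_product)
qed

section \<open>Counting exponent vectors of low degree\<close>

text \<open>Rankin's trick: give each vector the weight \<open>t\<close> to the power of its degree
  minus \<open>n * (q - 1) / 3\<close>. As \<open>t < 1\<close>, low vectors have weight at least 1,
  and the total weight of all vectors factorises into \<open>n\<close> equal geometric sums.\<close>

lemma card_low_exponents_le:
  assumes "q > 0" "0 < t" "t < 1"
  shows "real (card (low_exponents q n)) \<le>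
    ((1 - t powr real q) / (1 - t) * t powr (- ((real q - 1) / 3))) ^ n"
proof -
  let ?c = "t powr (- ((real q - 1) / 3))"
  have "real (card (low_exponents q n)) = (\<Sum>e\<in>low_exponents q n. 1)" by simp
  also have "\<dots> \<le> (\<Sum>e\<in>low_exponents q n. \<Prod>i<n. t ^ e i * ?c)"
  proof (rule sum_mono)
    fix e assume "e \<in> low_exponents q n"
    then have "3 * sum e {..<n} \<le> n * (q - 1)" by (simp add: low_exponents_def)
    then have "real (3 * sum e {..<n}) \<le> real (n * (q - 1))" by (rule of_nat_mono)
    then have "real (sum e {..<n}) + real n * (- ((real q - 1) / 3)) \<le> 0"
      using assms(1) by (simp add: of_nat_diff)
    then have "1 \<le> t powr (real (sum e {..<n}) + real n * (- ((real q - 1) / 3)))"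
      using assms powr_mono'[of "real (sum e {..<n}) + real n * (- ((real q - 1) / 3))" 0 t] by simp
    also have "\<dots> = t ^ sum e {..<n} * ?c ^ n"
      using assms unfolding powr_add by (subst powr_power) (auto simp del: of_nat_sum simp: powr_realpow)
    also have "\<dots> = (\<Prod>i<n. t ^ e i * ?c)"
      by (simp add: prod.distrib power_sum)
    finally show "1 \<le> (\<Prod>i<n. t ^ e i * ?c)" .
  qed
  also have "\<dots> \<le> (\<Sum>e\<in>{..<n} \<rightarrow>\<^sub>E {..<q}. \<Prod>i<n. t ^ e i * ?c)"
    using assms by (intro sum_mono2 prod_nonneg) (auto simp: low_exponents_def finite_PiE)
  also have "\<dots> = (\<Prod>i<n. \<Sum>j<q. t ^ j * ?c)"
    by (rule prod_sum_PiE[symmetric]) auto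
  also have "\<dots> = ((\<Sum>j<q. t ^ j) * ?c) ^ n" by (simp add: sum_distrib_right)
  also have "(\<Sum>j<q. t ^ j) = (1 - t powr real q) / (1 - t)"
    using assms by (simp add: sum_gp_strict powr_realpow)
  finally show ?thesis .
qed

text \<open>The \<open>n\<close>-th root of the previous bound is free of \<open>n\<close>, so the
  infimum over \<open>t\<close> is taken before raising to the power again. The case
  \<open>n = 0\<close> is separate because \<open>root 0\<close> does not invert the power.\<close>

lemma card_low_exponents_le_J_const:
  assumes "q > 0"
  shows "real (card (low_exponents q n)) \<le> (real q * J_const (real q)) ^ n"
proof (cases "n = 0")
  case True
  have "low_exponents q 0 = {\<lambda>_. undefined}" by (auto simp: low_exponents_def)
  then show ?thesis using True by simp
next
  case False
  let ?f = "\<lambda>t. (1 - t powr real q) / (1 - t) * t powr (- ((real q - 1) / 3))"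
  let ?N = "real (card (low_exponents q n))"
  have "root n ?N \<le> (INF t\<in>{0<..<1::real}. ?f t)"
  proof (rule cINF_greatest)
    fix t :: real assume t: "t \<in> {0<..<1}"
    then have "t powr real q \<le> 1" by (intro powr_le1) auto
    then have "?f t \<ge> 0" using t by (intro mult_nonneg_nonneg divide_nonneg_nonneg) auto
    moreover have "root n ?N \<le> root n (?f t ^ n)"
      using card_low_exponents_le[of q t n] assms t False by simp
    ultimately show "root n ?N \<le> ?f t" using False by (simp add: real_root_power_cancel)
  qed auto
  then have "root n ?N \<le> real q * J_const (real q)" using assms by (simp add: J_const_def)
  then have "root n ?N ^ n \<le> (real q * J_const (real q)) ^ n"
    using False by (intro power_mono) auto
  then show ?thesis using False by simp
qed

section \<open>Tricolored sum-free sets and transport along the isomorphism\<close>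

text \<open>A triple mixing entries of three elements still lies in
  \<open>S \<times> T \<times> U\<close>. If its product is one it belongs to \<open>M\<close>, and
  injectivity of the projections identifies it with each of the three elements.\<close>

lemma tricolored_sum_freeD:
  assumes "tricolored_sum_free H M" "m1 \<in> M" "m2 \<in> M" "m3 \<in> M"
  shows "fst m1 \<otimes>\<^bsub>H\<^esub> fst (snd m2) \<otimes>\<^bsub>H\<^esub> snd (snd m3) = \<one>\<^bsub>H\<^esub> \<longleftrightarrow> m1 = m2 \<and> m2 = m3"
proof -
  obtain S T U where M: "M \<subseteq> S \<times> T \<times> U"
    and inj: "inj_on (\<lambda>(s, t, u). s) M" "inj_on (\<lambda>(s, t, u). t) M" "inj_on (\<lambda>(s, t, u). u) M"
    and eq: "\<forall>(s, t, u) \<in> M. s \<otimes>\<^bsub>H\<^esub> t \<otimes>\<^bsub>H\<^esub> u = \<one>\<^bsub>H\<^esub>"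
    and neq: "\<forall>(s, t, u) \<in> S \<times> T \<times> U - M. s \<otimes>\<^bsub>H\<^esub> t \<otimes>\<^bsub>H\<^esub> u \<noteq> \<one>\<^bsub>H\<^esub>"
    using assms(1) unfolding tricolored_sum_free_def perfect_matching3_def bij_betw_def by metis
  let ?m = "(fst m1, fst (snd m2), snd (snd m3))"
  have STU: "?m \<in> S \<times> T \<times> U" using M assms by auto
  show ?thesis
  proof
    assume "fst m1 \<otimes>\<^bsub>H\<^esub> fst (snd m2) \<otimes>\<^bsub>H\<^esub> snd (snd m3) = \<one>\<^bsub>H\<^esub>"
    then have "?m \<in> M" using neq STU by blast
    then have "?m = m1" "?m = m2" "?m = m3"
      by (auto intro: inj_onD[OF inj(1)] inj_onD[OF inj(2)] inj_onD[OF inj(3)]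
          simp: assms case_prod_unfold simp del: prod.inject)
    then show "m1 = m2 \<and> m2 = m3" by simp
  next
    assume "m1 = m2 \<and> m2 = m3"
    then show "fst m1 \<otimes>\<^bsub>H\<^esub> fst (snd m2) \<otimes>\<^bsub>H\<^esub> snd (snd m3) = \<one>\<^bsub>H\<^esub>"
      using eq assms by (auto simp: case_prod_unfold)
  qed
qed

lemma tricolored_sum_free_subset:
  assumes "tricolored_sum_free H M"
  shows "M \<subseteq> carrier H \<times> carrier H \<times> carrier H"
  using assms unfolding tricolored_sum_free_def perfect_matching3_def by blast

theorem theorem4p14:
  fixes q n :: nat
    and G :: "('g, 'k) monoid_scheme"
    and H :: "('h, 'm) monoid_scheme"
    and M :: "('h \<times> 'h \<times> 'h) set"
  assumes "primepow q"
    and "comm_group G"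
    and "finite (carrier G)"
    and "comm_group H"
    and "H \<cong> product_group {..<n} (\<lambda>_. integer_mod_group q) \<times>\<times> G"
    and "tricolored_sum_free H M"
  shows "real (card M) \<le> 3 * real (card (carrier H)) * J_const (real q) ^ n"
proof -
  let ?Z = "product_group {..<n} (\<lambda>_. integer_mod_group q)"
  interpret G: comm_group G by fact
  interpret H: comm_group H by fact
  obtain p k where pk: "prime p" "q = p ^ k"
    using assms(1) unfolding primepow_def by blast
  then have q0: "q > 0" by (simp add: prime_gt_0_nat)
  obtain \<phi> where "\<phi> \<in> iso H (?Z \<times>\<times> G)" using assms(5) by (auto simp: is_iso_def)
  then have hom: "\<phi> \<in> hom H (?Z \<times>\<times> G)" and bij: "bij_betw \<phi> (carrier H) (carrier (?Z \<times>\<times> G))"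
    by (auto simp: iso_def)
  have "group (?Z \<times>\<times> G)" by (intro DirProd_group) auto
  then have one: "\<phi> \<one>\<^bsub>H\<^esub> = \<one>\<^bsub>?Z \<times>\<times> G\<^esub>" using hom by (intro hom_one) auto
  have carrier: "carrier (?Z \<times>\<times> G) = ({..<n} \<rightarrow>\<^sub>E {0..<int q}) \<times> carrier G"
    using q0 by (simp add: carrier_integer_mod_group)
  have cardH: "card (carrier H) = q ^ n * card (carrier G)"
    using bij_betw_same_card[OF bij] unfolding carrier
    by (simp add: card_cartesian_product card_PiE)
  have "finite (carrier H)"
    using bij_betw_finite[OF bij] assms(3) unfolding carrier by (simp add: finite_PiE)
  then have finM: "finite M"
    using finite_subset[OF tricolored_sum_free_subset[OF assms(6)]] by simp
  have M: "fst m \<in> carrier H" "fst (snd m) \<in> carrier H" "snd (snd m) \<in> carrier H" if "m \<in> M" for m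
    using tricolored_sum_free_subset[OF assms(6)] that by auto
  have \<phi>: "\<phi> s \<in> ({..<n} \<rightarrow>\<^sub>E {0..<int q}) \<times> carrier G" if "s \<in> carrier H" for s
    using bij_betwE[OF bij] that unfolding carrier by blast
  have product: "s \<otimes>\<^bsub>H\<^esub> t \<otimes>\<^bsub>H\<^esub> u = \<one>\<^bsub>H\<^esub> \<longleftrightarrow>
      (\<forall>i<n. q dvd nat (fst (\<phi> s) i) + nat (fst (\<phi> t) i) + nat (fst (\<phi> u) i)) \<and>
      snd (\<phi> s) \<otimes>\<^bsub>G\<^esub> snd (\<phi> t) \<otimes>\<^bsub>G\<^esub> snd (\<phi> u) = \<one>\<^bsub>G\<^esub>"
    if stu: "s \<in> carrier H" "t \<in> carrier H" "u \<in> carrier H" for s t u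
  proof -
    have dvd: "((fst (\<phi> s) i + fst (\<phi> t) i) mod int q + fst (\<phi> u) i) mod int q = 0 \<longleftrightarrow>
        q dvd nat (fst (\<phi> s) i) + nat (fst (\<phi> t) i) + nat (fst (\<phi> u) i)" if "i < n" for i
    proof -
      \<comment> \<open>Representatives are nonnegative, so \<open>nat\<close> loses nothing and
        divisibility of the sum passes between integers and natural numbers.\<close>
      have "fst (\<phi> v) i \<in> {0..<int q}" if "v \<in> carrier H" for v
      proof -
        have "fst (\<phi> v) \<in> {..<n} \<rightarrow>\<^sub>E {0..<int q}" using \<phi>[OF that] by (simp add: mem_Times_iff)
        then show ?thesis using PiE_mem[of _ "{..<n}" "\<lambda>_. {0..<int q}" i] \<open>i < n\<close> by simp
      qed
      then have "int (nat (fst (\<phi> s) i) + nat (fst (\<phi> t) i) + nat (fst (\<phi> u) i)) =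
          fst (\<phi> s) i + fst (\<phi> t) i + fst (\<phi> u) i" using stu by simp
      then have "q dvd nat (fst (\<phi> s) i) + nat (fst (\<phi> t) i) + nat (fst (\<phi> u) i) \<longleftrightarrow>
          int q dvd fst (\<phi> s) i + fst (\<phi> t) i + fst (\<phi> u) i"
        by (metis int_dvd_int_iff)
      then show ?thesis by (simp add: dvd_eq_mod_eq_0 mod_add_left_eq)
    qed
    have "s \<otimes>\<^bsub>H\<^esub> t \<otimes>\<^bsub>H\<^esub> u = \<one>\<^bsub>H\<^esub> \<longleftrightarrow> \<phi> (s \<otimes>\<^bsub>H\<^esub> t \<otimes>\<^bsub>H\<^esub> u) = \<phi> \<one>\<^bsub>H\<^esub>"
      using bij_betw_imp_inj_on[OF bij] stu by (auto dest: inj_onD)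
    also have "\<phi> (s \<otimes>\<^bsub>H\<^esub> t \<otimes>\<^bsub>H\<^esub> u) = \<phi> s \<otimes>\<^bsub>?Z \<times>\<times> G\<^esub> \<phi> t \<otimes>\<^bsub>?Z \<times>\<times> G\<^esub> \<phi> u"
      using hom stu by (simp add: hom_mult)
    also have "\<dots> = \<phi> \<one>\<^bsub>H\<^esub> \<longleftrightarrow>
        (\<forall>i<n. ((fst (\<phi> s) i + fst (\<phi> t) i) mod int q + fst (\<phi> u) i) mod int q = 0) \<and>
        snd (\<phi> s) \<otimes>\<^bsub>G\<^esub> snd (\<phi> t) \<otimes>\<^bsub>G\<^esub> snd (\<phi> u) = \<one>\<^bsub>G\<^esub>"
      unfolding one by (auto simp: mult_DirProd' restrict_def fun_eq_iff)
    finally show ?thesis using dvd by auto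
  qed
  have "card M \<le> 3 * (card (low_exponents q n) * card (carrier G))"
    by (rule matching_card_bound[where a = "\<lambda>m i. nat (fst (\<phi> (fst m)) i)"
          and b = "\<lambda>m i. nat (fst (\<phi> (fst (snd m))) i)" and c = "\<lambda>m i. nat (fst (\<phi> (snd (snd m))) i)"
          and x = "\<lambda>m. snd (\<phi> (fst m))" and y = "\<lambda>m. snd (\<phi> (fst (snd m)))"
          and z = "\<lambda>m. snd (\<phi> (snd (snd m)))", OF pk G.is_group assms(3) finM])
      (use M \<phi> in \<open>auto simp: mem_Times_iff tricolored_sum_freeD[OF assms(6)] simp flip: product\<close>)
  then have "real (card M) \<le> 3 * (real (card (low_exponents q n)) * real (card (carrier G)))"
    by (metis of_nat_le_iff of_nat_mult of_nat_numeral)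
  also have "\<dots> \<le> 3 * ((real q * J_const (real q)) ^ n * real (card (carrier G)))"
    using card_low_exponents_le_J_const[OF q0] by (intro mult_left_mono mult_right_mono) auto
  \<comment> \<open>The factor \<open>real q ^ n\<close> and the order of \<open>G\<close> combine
    to the order of \<open>H\<close>.\<close>
  also have "\<dots> = 3 * real (card (carrier H)) * J_const (real q) ^ n"
    by (simp add: cardH power_mult_distrib)
  finally show ?thesis .
qed

end
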